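(* Let $(X,A,m,\alpha)$ be a micro-macro system and $0<\varepsilon<\frac12$. Suppose there is a map $t:A\to A$ with $[\alpha]_{a,t(a)}\ge 1-\varepsilon$ for all $a\in A$, and suppose that for all $a,b\in A$, $S(a)<S(b)$ implies $S(a)<S(b)+\ln(1-\varepsilon)$. Then $\frac{|D|}{|X|}\le\varepsilon$.
   Context: A micro-macro system $(X,A,m,\alpha)$ consists of finite sets $X$, $A$, a bijection $\alpha:X\to X$ and a surjection $m:X\to A$; identify $a\in A$ with $m^{-1}(a)$, $|a|=|m^{-1}(a)|$, $S(a)=\ln|a|$, $S(i)=\ln|m(i)|$ for $i\in X$. The transition probability is $[\alpha]_{ab}=\frac{|\{i\in a:\alpha(i)\in b\}|}{|a|}$. $D=\{i\in X: S(\alpha i)<S(i)\}$. *)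

theory Defs
  imports Complex_Main "HOL-Library.FuncSet"
begin

locale micro_macro_system =
  fixes X :: "'x set" and A :: "'a set" and m :: "'x \<Rightarrow> 'a" and \<alpha> :: "'x \<Rightarrow> 'x"
  assumes finite_X: "finite X"
    and finite_A: "finite A"
    and bij_\<alpha>: "bij_betw \<alpha> X X"
    and surj_m: "m ` X = A"

definition zone :: "'x set \<Rightarrow> ('x \<Rightarrow> 'a) \<Rightarrow> 'a \<Rightarrow> 'x set" where
  "zone X m a = {i \<in> X. m i = a}"

definition macro_entropy :: "'x set \<Rightarrow> ('x \<Rightarrow> 'a) \<Rightarrow> 'a \<Rightarrow> real" where
  "macro_entropy X m a = ln (real (card (zone X m a)))"

definition micro_entropy :: "'x set \<Rightarrow> ('x \<Rightarrow> 'a) \<Rightarrow> 'x \<Rightarrow> real" where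
  "micro_entropy X m i = macro_entropy X m (m i)"

definition transition_prob ::
  "'x set \<Rightarrow> ('x \<Rightarrow> 'a) \<Rightarrow> ('x \<Rightarrow> 'x) \<Rightarrow> 'a \<Rightarrow> 'a \<Rightarrow> real" where
  "transition_prob X m \<alpha> a b =
     real (card {i \<in> zone X m a. \<alpha> i \<in> zone X m b}) / real (card (zone X m a))"

definition decreasing_set :: "'x set \<Rightarrow> ('x \<Rightarrow> 'a) \<Rightarrow> ('x \<Rightarrow> 'x) \<Rightarrow> 'x set" where
  "decreasing_set X m \<alpha> = {i \<in> X. micro_entropy X m (\<alpha> i) < micro_entropy X m i}"

end

theory Submission
  imports Defs
begin

text \<open>
  Injectivity of \<open>\<alpha>\<close> gives \<open>|t(a)| \<ge> (1 - \<epsilon>) |a|\<close>, so \<open>S(t(a)) \<ge> S(a) + ln (1 - \<epsilon>)\<close>, and the gap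
  condition upgrades this to \<open>S(t(a)) \<ge> S(a)\<close>. Hence a decreasing microstate in \<open>a\<close> is one of the
  at most \<open>\<epsilon> |a|\<close> microstates not sent to \<open>t(a)\<close>.
\<close>

context micro_macro_system
begin

lemma finite_zone: "finite (zone X m a)"
  using finite_X by (simp add: zone_def)

text \<open>Surjectivity of \<open>m\<close> rules out empty zones, so quotients by
  \<open>card (zone X m a)\<close> and logarithms of it never take default values.\<close>

lemma card_zone_pos: "a \<in> A \<Longrightarrow> 0 < card (zone X m a)"
  using surj_m finite_zone[of a] by (auto simp: card_gt_0_iff zone_def)

text \<open>\<open>\<alpha>\<close> embeds the transition set into the target zone. This is the only
  place where injectivity of the dynamics enters.\<close>

lemma card_transition_le: "card {i \<in> zone X m a. \<alpha> i \<in> zone X m b} \<le> card (zone X m b)"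
proof (rule card_inj_on_le)
  show "inj_on \<alpha> {i \<in> zone X m a. \<alpha> i \<in> zone X m b}"
    using bij_\<alpha> by (auto simp: bij_betw_def zone_def intro: inj_on_subset)
qed (auto simp: finite_zone)

lemma macro_entropy_ge_of_transition_prob_ge:
  assumes "a \<in> A" "b \<in> A" "0 < p" "p \<le> transition_prob X m \<alpha> a b"
  shows "macro_entropy X m a + ln p \<le> macro_entropy X m b"
proof -
  have pos: "0 < card (zone X m a)"
    using assms(1) by (rule card_zone_pos)
  have "real (card (zone X m a)) * p \<le> card {i \<in> zone X m a. \<alpha> i \<in> zone X m b}"
    using assms(4) pos by (simp add: transition_prob_def field_simps)
  also have "\<dots> \<le> card (zone X m b)"
    using card_transition_le by simp
  finally have "ln (real (card (zone X m a)) * p) \<le> ln (real (card (zone X m b)))"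
    using pos assms(3) by (intro ln_mono) auto
  then show ?thesis
    using pos assms(3) by (simp add: macro_entropy_def ln_mult)
qed

lemma card_decreasing_zone_le:
  fixes \<epsilon> :: real
  assumes "a \<in> A" "1 - \<epsilon> \<le> transition_prob X m \<alpha> a b"
    and "macro_entropy X m a \<le> macro_entropy X m b"
  shows "card (decreasing_set X m \<alpha> \<inter> zone X m a) \<le> \<epsilon> * card (zone X m a)"
proof -
  let ?T = "{i \<in> zone X m a. \<alpha> i \<in> zone X m b}"
  \<comment> \<open>Microstates of \<open>a\<close> sent into \<open>b\<close> do not lose entropy,
    as \<open>b\<close> has at least the entropy of \<open>a\<close>.\<close>
  have "decreasing_set X m \<alpha> \<inter> zone X m a \<subseteq> zone X m a - ?T"
    using assms(3) by (auto simp: decreasing_set_def micro_entropy_def zone_def)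
  then have "card (decreasing_set X m \<alpha> \<inter> zone X m a) \<le> card (zone X m a - ?T)"
    by (intro card_mono) (auto simp: finite_zone)
  also have "\<dots> = card (zone X m a) - card ?T"
    by (intro card_Diff_subset) (auto simp: finite_zone)
  \<comment> \<open>The difference of cardinalities is truncated, so moving \<open>card ?T\<close>
    across needs \<open>card ?T \<le> card (zone X m a)\<close>.\<close>
  finally have "card (decreasing_set X m \<alpha> \<inter> zone X m a) + card ?T \<le> card (zone X m a)"
    using card_mono[OF finite_zone, of ?T a] by auto
  moreover have "(1 - \<epsilon>) * card (zone X m a) \<le> card ?T"
    using assms(2) card_zone_pos[OF assms(1)] by (simp add: transition_prob_def field_simps)
  ultimately show ?thesis
    by (simp add: algebra_simps)
qed

text \<open>The zones are the fibres of \<open>m\<close>, hence partition \<open>X\<close>. Applied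
  to both the decreasing set and \<open>X\<close>, this makes the zonewise bounds global.\<close>

lemma card_eq_sum_zones:
  assumes "Y \<subseteq> X"
  shows "card Y = (\<Sum>a\<in>A. card (Y \<inter> zone X m a))"
proof -
  have "Y = (\<Union>a\<in>A. Y \<inter> zone X m a)"
    using assms surj_m by (auto simp: zone_def)
  then have "card Y = card (\<Union>a\<in>A. Y \<inter> zone X m a)"
    by simp
  also have "\<dots> = (\<Sum>a\<in>A. card (Y \<inter> zone X m a))"
    by (intro card_UN_disjoint) (auto simp: finite_A finite_X zone_def)
  finally show ?thesis .
qed

end

theorem theorem14:
  fixes X :: "'x set" and A :: "'a set" and m :: "'x \<Rightarrow> 'a" and \<alpha> :: "'x \<Rightarrow> 'x"
    and t :: "'a \<Rightarrow> 'a" and \<epsilon> :: real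
  assumes "micro_macro_system X A m \<alpha>"
    and "0 < \<epsilon>" and "\<epsilon> < 1 / 2"
    and "t \<in> A \<rightarrow> A"
    and "\<And>a. a \<in> A \<Longrightarrow> transition_prob X m \<alpha> a (t a) \<ge> 1 - \<epsilon>"
    and "\<And>a b. a \<in> A \<Longrightarrow> b \<in> A \<Longrightarrow> macro_entropy X m a < macro_entropy X m b \<Longrightarrow>
           macro_entropy X m a < macro_entropy X m b + ln (1 - \<epsilon>)"
  shows "real (card (decreasing_set X m \<alpha>)) / real (card X) \<le> \<epsilon>"
proof -
  interpret micro_macro_system X A m \<alpha> by fact
  let ?D = "decreasing_set X m \<alpha>"
  \<comment> \<open>The redundant intersection with \<open>X\<close> matches the summands of
    \<open>card_eq_sum_zones\<close> for \<open>Y = X\<close>.\<close>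
  have zone_le: "card (?D \<inter> zone X m a) \<le> \<epsilon> * card (X \<inter> zone X m a)" if a: "a \<in> A" for a
  proof -
    have ta: "t a \<in> A"
      using assms(4) a by auto
    have "macro_entropy X m a + ln (1 - \<epsilon>) \<le> macro_entropy X m (t a)"
      using assms(3) assms(5)[OF a] by (intro macro_entropy_ge_of_transition_prob_ge a ta) auto
    \<comment> \<open>If \<open>t a\<close> had smaller entropy than \<open>a\<close>, the gap
      condition for the pair \<open>t a\<close>, \<open>a\<close> would contradict the bound just
      obtained.\<close>
    then have "macro_entropy X m a \<le> macro_entropy X m (t a)"
      using assms(6)[OF ta a] by linarith
    moreover have "X \<inter> zone X m a = zone X m a"
      by (auto simp: zone_def)
    ultimately show ?thesis
      using card_decreasing_zone_le[OF a assms(5)[OF a]] by simp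
  qed
  have "real (card ?D) = (\<Sum>a\<in>A. real (card (?D \<inter> zone X m a)))"
    by (subst card_eq_sum_zones) (auto simp: decreasing_set_def)
  also have "\<dots> \<le> (\<Sum>a\<in>A. \<epsilon> * card (X \<inter> zone X m a))"
    by (intro sum_mono zone_le)
  also have "\<dots> = \<epsilon> * card X"
    by (subst card_eq_sum_zones[of X]) (auto simp: sum_distrib_left)
  \<comment> \<open>For empty \<open>X\<close> the quotient is 0 by the convention for division by
    zero, and \<open>0 < \<epsilon>\<close> suffices.\<close>
  finally show ?thesis
    using assms(2) by (cases "card X = 0") (auto simp: field_simps)
qed

end
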